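(* Let $n$ be a positive integer, let $R$ be an exchange ring and let $I$ be an ideal of $R$. Then the elementary subgroup $\operatorname{E}_n(R,I)$ of level $I$ is a normal subgroup of $\operatorname{GL}_n(R)$.
   Context: Rings are associative with $1\neq 0$ (not necessarily commutative); an ideal means a two-sided ideal. A left $R$-module $M$ has the exchange property if for any module $X$ and decompositions $X=M'\oplus Y=\bigoplus_{\lambda\in\Lambda}N_\lambda$ with $M'\cong M$ (arbitrary index set $\Lambda$), there exist submodules $N'_\lambda\subseteq N_\lambda$ for each $\lambda$ such that $X=M'\oplus\bigoplus_{\lambda\in\Lambda}N'_\lambda$. A ring $R$ is an exchange ring if ${}_RR$ has the exchange property; equivalently (Nicholson), for every $x\in R$ there is an idempotent $e\in xR$ such that $1-e\in(1-x)R$. $\operatorname{GL}_n(R)$ is the group of invertible $n\times n$ matrices over $R$. Write $e$ for the identity matrix and $e^{ij}$ for the matrix with $1$ at position $(i,j)$ and zeros elsewhere. For $i\neq j$ in $\{1,\dots,n\}$ and $x\in R$, the elementary transvection is $t_{ij}(x)=e+xe^{ij}$. The elementary subgroup $\operatorname{E}_n(R)$ is the subgroup of $\operatorname{GL}_n(R)$ generated by all elementary transvections (trivial if $n=1$). For an ideal $I$ of $R$, $\operatorname{E}_n(I)$ is the subgroup generated by all $t_{ij}(x)$ with $x\in I$, $i\ne j$, and $\operatorname{E}_n(R,I)$ is the normal closure of $\operatorname{E}_n(I)$ in $\operatorname{E}_n(R)$. *)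

theory Defs
  imports
    "HOL-Algebra.Algebraic_Closure_Type"
    "HOL-Algebra.Generated_Groups"
    "Jordan_Normal_Form.Matrix"
begin

text \<open>The module locale of \<open>HOL-Algebra\<close> requires a commutative ring of scalars.\<close>

locale left_module = R?: ring R + M?: abelian_group M
  for R :: "('a, 'c) ring_scheme" (structure)
    and M :: "('a, 'b, 'd) module_scheme" (structure) +
  assumes smult_closed:
      "\<lbrakk>a \<in> carrier R; x \<in> carrier M\<rbrakk> \<Longrightarrow> a \<odot>\<^bsub>M\<^esub> x \<in> carrier M"
    and smult_l_distr:
      "\<lbrakk>a \<in> carrier R; b \<in> carrier R; x \<in> carrier M\<rbrakk> \<Longrightarrow>
        (a \<oplus>\<^bsub>R\<^esub> b) \<odot>\<^bsub>M\<^esub> x = a \<odot>\<^bsub>M\<^esub> x \<oplus>\<^bsub>M\<^esub> b \<odot>\<^bsub>M\<^esub> x"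
    and smult_r_distr:
      "\<lbrakk>a \<in> carrier R; x \<in> carrier M; y \<in> carrier M\<rbrakk> \<Longrightarrow>
        a \<odot>\<^bsub>M\<^esub> (x \<oplus>\<^bsub>M\<^esub> y) = a \<odot>\<^bsub>M\<^esub> x \<oplus>\<^bsub>M\<^esub> a \<odot>\<^bsub>M\<^esub> y"
    and smult_assoc1:
      "\<lbrakk>a \<in> carrier R; b \<in> carrier R; x \<in> carrier M\<rbrakk> \<Longrightarrow>
        (a \<otimes>\<^bsub>R\<^esub> b) \<odot>\<^bsub>M\<^esub> x = a \<odot>\<^bsub>M\<^esub> (b \<odot>\<^bsub>M\<^esub> x)"
    and smult_one:
      "x \<in> carrier M \<Longrightarrow> \<one>\<^bsub>R\<^esub> \<odot>\<^bsub>M\<^esub> x = x"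

definition left_regular_module :: "('a, 'c) ring_scheme \<Rightarrow> ('a, 'a) module" where
  "left_regular_module R =
    \<lparr>carrier = carrier R, monoid.mult = monoid.mult R, one = one R,
     zero = zero R, add = add R, module.smult = monoid.mult R\<rparr>"

definition module_iso_onto ::
  "('a, 'c) ring_scheme \<Rightarrow> ('a, 'b, 'd) module_scheme \<Rightarrow> ('a, 'x, 'e) module_scheme \<Rightarrow>
    'x set \<Rightarrow> ('b \<Rightarrow> 'x) \<Rightarrow> bool" where
  "module_iso_onto R M A N f \<longleftrightarrow>
    bij_betw f (carrier M) N \<and>
    (\<forall>x\<in>carrier M. \<forall>y\<in>carrier M. f (x \<oplus>\<^bsub>M\<^esub> y) = f x \<oplus>\<^bsub>A\<^esub> f y) \<and>
    (\<forall>a\<in>carrier R. \<forall>x\<in>carrier M. f (a \<odot>\<^bsub>M\<^esub> x) = a \<odot>\<^bsub>A\<^esub> f x)"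

text \<open>\<open>A\<close> is the internal direct sum of the submodules \<open>N l\<close>, \<open>l \<in> L\<close>: every element of
  \<open>A\<close> has exactly one expression as a sum of a finitely supported choice of elements of the \<open>N l\<close>.\<close>

definition internal_direct_sum ::
  "('a, 'c) ring_scheme \<Rightarrow> ('a, 'x, 'e) module_scheme \<Rightarrow> 'i set \<Rightarrow> ('i \<Rightarrow> 'x set) \<Rightarrow> bool" where
  "internal_direct_sum R A L N \<longleftrightarrow>
    (\<forall>l\<in>L. submodule (N l) R A) \<and>
    (\<forall>x\<in>carrier A. \<exists>!f. f \<in> (\<Pi>\<^sub>E l\<in>L. N l) \<and> finite {l \<in> L. f l \<noteq> \<zero>\<^bsub>A\<^esub>} \<and>
        x = (\<Oplus>\<^bsub>A\<^esub>l\<in>{l \<in> L. f l \<noteq> \<zero>\<^bsub>A\<^esub>}. f l))"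

text \<open>The exchange property of \<open>M\<close> with respect to all left modules \<open>A\<close> whose carrier is a set of
  elements of \<open>'x\<close>. It is no restriction to take the index set \<open>L\<close> inside \<open>'x\<close> too: zero summands
  play no role, and a nonzero summand of \<open>A\<close> may be indexed by any one of its nonzero elements.
  The decomposition into \<open>M'\<close> and \<open>Y\<close> is indexed by \<^typ>\<open>bool\<close>, the one into \<open>M'\<close> and the
  \<open>N' l\<close> by \<^const>\<open>None\<close> and the \<open>Some l\<close>.\<close>

definition exchange_property ::
  "'x itself \<Rightarrow> ('a, 'c) ring_scheme \<Rightarrow> ('a, 'b, 'd) module_scheme \<Rightarrow> bool" where
  "exchange_property ty R M \<longleftrightarrow>
    (\<forall>(A :: ('a, 'x) module) M' Y (L :: 'x set) N.
      left_module R A \<and>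
      (\<exists>f. module_iso_onto R M A M' f) \<and>
      internal_direct_sum R A UNIV (\<lambda>b. if b then M' else Y) \<and>
      internal_direct_sum R A L N \<longrightarrow>
      (\<exists>N'. (\<forall>l\<in>L. submodule (N' l) R A \<and> N' l \<subseteq> N l) \<and>
            internal_direct_sum R A (insert None (Some ` L)) (case_option M' N')))"

text \<open>HOL cannot quantify over types, so the universe from which the modules \<open>A\<close> are drawn has to
  be fixed. Up to isomorphism, \<open>nat \<Rightarrow> 'a\<close> contains all countably generated left modules over \<open>R\<close>.
  Nothing is lost: Nicholson's condition already follows from the exchange property of \<open>R\<close>
  inside modules isomorphic to the direct sum of two copies of \<open>R\<close>, and it implies the exchange
  property of \<open>R\<close> inside modules of any size.\<close>

definition exchange_ring :: "('a, 'c) ring_scheme \<Rightarrow> bool" where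
  "exchange_ring R \<longleftrightarrow>
    ring R \<and> exchange_property TYPE(nat \<Rightarrow> 'a) R (left_regular_module R)"

text \<open>Rows and columns are numbered from \<open>0\<close> to \<open>n - 1\<close>.\<close>

definition general_linear_group :: "'a::ring_1 itself \<Rightarrow> nat \<Rightarrow> 'a mat monoid" where
  "general_linear_group ty n = units_of (ring_mat ty n ())"

definition matrix_unit :: "nat \<Rightarrow> nat \<Rightarrow> nat \<Rightarrow> 'a::ring_1 mat" where
  "matrix_unit n i j = mat n n (\<lambda>(k, l). if k = i \<and> l = j then 1 else 0)"

definition transvection :: "nat \<Rightarrow> nat \<Rightarrow> nat \<Rightarrow> 'a::ring_1 \<Rightarrow> 'a mat" where
  "transvection n i j x = 1\<^sub>m n + x \<cdot>\<^sub>m matrix_unit n i j"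

definition elementary_subgroup :: "nat \<Rightarrow> 'a::ring_1 set \<Rightarrow> 'a mat set" where
  "elementary_subgroup n I =
    generate (general_linear_group TYPE('a) n)
      {transvection n i j x | i j x. i < n \<and> j < n \<and> i \<noteq> j \<and> x \<in> I}"

definition normal_closure :: "('g, 'h) monoid_scheme \<Rightarrow> 'g set \<Rightarrow> 'g set" where
  "normal_closure G S = \<Inter> {N. N \<lhd> G \<and> S \<subseteq> N}"

definition elementary_subgroup_of_level :: "nat \<Rightarrow> 'a::ring_1 set \<Rightarrow> 'a mat set" where
  "elementary_subgroup_of_level n I =
    normal_closure
      ((general_linear_group TYPE('a) n)\<lparr>carrier := elementary_subgroup n UNIV\<rparr>)
      (elementary_subgroup n I)"

end

theory Submission
  imports Defs
begin

text \<open>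
  For \<open>g \<in> GL\<^sub>n(R)\<close> with \<open>v\<close> the \<open>j\<close>-th row of \<open>g\<close>'s inverse and \<open>u\<close> the \<open>i\<close>-th column of \<open>g\<close>, the
  conjugate \<open>g t\<^sub>i\<^sub>j(x) g\<^sup>-\<^sup>1\<close> is \<open>1 + u x v\<close>, where \<open>v u = 0\<close> and \<open>v\<close> is right unimodular, say
  \<open>v u' = 1\<close>. Applying the exchange property to \<open>R\<^sup>n = R v \<oplus> {y. y u' = 0}\<close> and to the coordinate
  decomposition of \<open>R\<^sup>n\<close> yields \<open>c\<^sub>k\<close> such that the \<open>f\<^sub>k = v\<^sub>k c\<^sub>k\<close> are idempotents with sum \<open>1\<close>.
  Since \<open>v u = 0\<close>, the matrix \<open>1 + u x v\<close> is the product of the \<open>1 + u x f\<^sub>k v\<close>. The entries of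
  \<open>f\<^sub>k v\<close> are right multiples of its \<open>k\<close>-th one, so elementary column operations clear all others,
  and what remains differs from the identity in column \<open>k\<close> only. Such a matrix is a product of
  transvections and of \<open>diag(1, \<dots>, 1 + y z, \<dots>, 1)\<close> with \<open>y \<in> I\<close> and \<open>z y = 0\<close>, which is the commutator
  of \<open>t\<^sub>k\<^sub>l(y)\<close> and \<open>t\<^sub>l\<^sub>k(z)\<close>. This works for \<open>n = 2\<close> as well.
\<close>

subsection \<open>Idempotents from the exchange property\<close>

text \<open>Think of the rows \<open>y\<close> with every \<open>y l\<close> in \<open>J l\<close>
  as a complement of \<open>R w\<close> in the free module with basis \<open>e\<^sub>k\<close>. The
  assumptions \<open>off\<close> and \<open>diag\<close> then say that \<open>e\<^sub>k\<close>
  agrees with \<open>c\<^sub>k w\<close> modulo this complement, and \<open>indep\<close> that no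
  nonzero \<open>r\<close> has \<open>r w\<close> in it.\<close>

lemma left_ideal_complement_idempotents:
  fixes w c :: "nat \<Rightarrow> 'r::ring_1" and J :: "nat \<Rightarrow> 'r set"
  assumes add: "\<And>k a b. k < n \<Longrightarrow> a \<in> J k \<Longrightarrow> b \<in> J k \<Longrightarrow> a + b \<in> J k"
    and lmult: "\<And>k a r. k < n \<Longrightarrow> a \<in> J k \<Longrightarrow> r * a \<in> J k"
    and zero: "\<And>k. k < n \<Longrightarrow> 0 \<in> J k"
    and off: "\<And>k l. k < n \<Longrightarrow> l < n \<Longrightarrow> l \<noteq> k \<Longrightarrow> c k * w l \<in> J l"
    and diag: "\<And>k. k < n \<Longrightarrow> 1 - c k * w k \<in> J k"
    and indep: "\<And>r. (\<And>l. l < n \<Longrightarrow> r * w l \<in> J l) \<Longrightarrow> r = 0"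
  shows "\<And>k. k < n \<Longrightarrow> w k * c k * (w k * c k) = w k * c k"
    and "(\<Sum>k<n. w k * c k) = 1"
proof -
  have neg: "- a \<in> J k" if "k < n" "a \<in> J k" for k a
    using lmult[OF that, of "- 1"] by simp
  have diff: "a - b \<in> J k" if "k < n" "a \<in> J k" "b \<in> J k" for k a b
    using add[OF that(1,2) neg[OF that(1,3)]] by simp
  \<comment> \<open>Both \<open>s e\<^sub>k\<close> and \<open>s (e\<^sub>k - c\<^sub>k w)\<close>
    lie in the complement, hence so does their difference \<open>s c\<^sub>k w\<close>. With
    \<open>s = 1 - c k * w k\<close> this yields \<open>c k = c k * w k * c k\<close>.\<close>
  have ann: "s * c k = 0" if "k < n" "s \<in> J k" for s k
  proof (rule indep)
    fix l assume l: "l < n"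
    show "s * c k * w l \<in> J l"
    proof (cases "l = k")
      case True
      have "s - s * (1 - c k * w k) \<in> J k"
        by (intro diff lmult diag that)
      then show ?thesis using True by (simp add: algebra_simps)
    next
      case False
      then show ?thesis using lmult[OF l off[OF that(1) l False], of s] by (simp add: mult.assoc)
    qed
  qed
  show "w k * c k * (w k * c k) = w k * c k" if "k < n" for k
  proof -
    have "c k * (w k * c k) = c k"
      using ann[OF that diag[OF that]] by (simp add: algebra_simps)
    then show ?thesis by (simp add: mult.assoc)
  qed
  \<comment> \<open>Modulo the complement, \<open>w\<close> is the sum of the
    \<open>w\<^sub>k e\<^sub>k\<close> and so agrees with the sum of the
    \<open>w\<^sub>k c\<^sub>k w\<close>.\<close>
  have "1 - (\<Sum>k<n. w k * c k) = 0"
  proof (rule indep)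
    fix l assume l: "l < n"
    have sumJ: "(\<Sum>k\<in>A. w k * c k * w l) \<in> J l" if "finite A" "A \<subseteq> {..<n} - {l}" for A
      using that
    proof (induction A rule: finite_induct)
      case empty then show ?case using zero l by simp
    next
      case (insert k A)
      then have "w k * (c k * w l) \<in> J l" using lmult[OF l off[of k l], of "w k"] l by auto
      then show ?case using insert add[OF l] by (simp add: mult.assoc)
    qed
    have "w l * (1 - c l * w l) - (\<Sum>k\<in>{..<n} - {l}. w k * c k * w l) \<in> J l"
      using l by (intro diff lmult diag sumJ) auto
    moreover have "(\<Sum>k<n. w k * c k * w l) = w l * c l * w l + (\<Sum>k\<in>{..<n} - {l}. w k * c k * w l)"
      using l by (subst sum.remove[of _ l]) auto
    ultimately show "(1 - (\<Sum>k<n. w k * c k)) * w l \<in> J l"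
      by (simp add: algebra_simps sum_distrib_left sum_distrib_right)
  qed
  then show "(\<Sum>k<n. w k * c k) = 1" by simp
qed

section \<open>The left module of rows of length \<open>n\<close> and its finite
  decompositions\<close>

text \<open>Rows are functions vanishing from \<open>n\<close> on, which places them in the type
  \<open>nat \<Rightarrow> 'r\<close> from which \<open>exchange_ring\<close> draws its
  modules.\<close>

definition row_module :: "nat \<Rightarrow> ('r::ring_1, nat \<Rightarrow> 'r) module" where
  "row_module n = \<lparr>carrier = {y. \<forall>k\<ge>n. y k = 0}, monoid.mult = undefined, one = undefined,
     zero = (\<lambda>_. 0), add = (\<lambda>x y k. x k + y k), module.smult = (\<lambda>a x k. a * x k)\<rparr>"

lemma left_module_row_module:
  assumes "ring (ring_of_type_algebra :: 'r::ring_1 ring)"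
  shows "left_module (ring_of_type_algebra :: 'r ring) (row_module n)"
proof -
  interpret ring "ring_of_type_algebra :: 'r ring" by fact
  have "\<exists>y\<in>{y. \<forall>k\<ge>n. y k = 0}. (\<forall>k. y k + x k = 0) \<and> (\<forall>k. x k + y k = 0)"
    if "\<forall>k\<ge>n. x k = 0" for x :: "nat \<Rightarrow> 'r"
    using that by (intro bexI[of _ "\<lambda>k. - x k"]) auto
  then show ?thesis
    by unfold_locales
      (auto simp: row_module_def ring_of_type_algebra_def algebra_simps Units_def fun_eq_iff)
qed

lemma submodule_row_moduleI:
  assumes "ring (ring_of_type_algebra :: 'r::ring_1 ring)"
    and "\<And>y k. y \<in> H \<Longrightarrow> k \<ge> n \<Longrightarrow> y k = 0" "(\<lambda>_. 0) \<in> H"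
    and "\<And>x y. x \<in> H \<Longrightarrow> y \<in> H \<Longrightarrow> (\<lambda>k. x k + y k) \<in> H"
    and smult: "\<And>a x. x \<in> H \<Longrightarrow> (\<lambda>k. a * x k) \<in> H"
  shows "submodule H (ring_of_type_algebra :: 'r ring) (row_module n)"
proof -
  interpret left_module "ring_of_type_algebra :: 'r ring" "row_module n :: ('r, nat \<Rightarrow> 'r) module"
    by (rule left_module_row_module) fact
  have "inv\<^bsub>add_monoid (row_module n)\<^esub> x = (\<lambda>k. - x k)" if "x \<in> H" for x
    using that assms(2)
    by (intro group.inv_equality[OF M.a_group]) (auto simp: row_module_def fun_eq_iff)
  moreover have "(\<lambda>k. - x k) \<in> H" if "x \<in> H" for x
    using smult[OF that, of "- 1"] by simp
  ultimately show ?thesis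
    using assms
    by unfold_locales (auto simp: row_module_def)
qed

lemma submodule_row_moduleD:
  assumes "submodule H (ring_of_type_algebra :: 'r::ring_1 ring) (row_module n)"
  shows "\<And>y k. y \<in> H \<Longrightarrow> k \<ge> n \<Longrightarrow> y k = 0" "(\<lambda>_. 0) \<in> H"
    "\<And>x y. x \<in> H \<Longrightarrow> y \<in> H \<Longrightarrow> (\<lambda>k. x k + y k) \<in> H"
    "\<And>a x. x \<in> H \<Longrightarrow> (\<lambda>k. a * x k) \<in> H"
proof -
  interpret submodule H "ring_of_type_algebra :: 'r ring" "row_module n" by fact
  show "\<And>y k. y \<in> H \<Longrightarrow> k \<ge> n \<Longrightarrow> y k = 0" "(\<lambda>_. 0) \<in> H"
    "\<And>x y. x \<in> H \<Longrightarrow> y \<in> H \<Longrightarrow> (\<lambda>k. x k + y k) \<in> H"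
    "\<And>a x. x \<in> H \<Longrightarrow> (\<lambda>k. a * x k) \<in> H"
    using subset one_closed m_closed smult_closed by (auto simp: row_module_def ring_of_type_algebra_def)
qed

lemma finsum_row_module:
  assumes "ring (ring_of_type_algebra :: 'r::ring_1 ring)"
    and "finite A" "\<And>a k. a \<in> A \<Longrightarrow> k \<ge> n \<Longrightarrow> f a k = 0"
  shows "finsum (row_module n :: ('r, nat \<Rightarrow> 'r) module) f A = (\<lambda>k. \<Sum>a\<in>A. f a k)"
proof -
  interpret left_module "ring_of_type_algebra :: 'r ring" "row_module n :: ('r, nat \<Rightarrow> 'r) module"
    by (rule left_module_row_module) fact
  show ?thesis
    using assms(2,3)
  proof (induction A rule: finite_induct)
    case empty
    then show ?case by (simp only: M.finsum_empty) (simp add: row_module_def)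
  next
    case (insert a A)
    have "finsum (row_module n) f (insert a A) = f a \<oplus>\<^bsub>row_module n\<^esub> finsum (row_module n) f A"
      using insert by (intro M.finsum_insert) (auto simp: row_module_def)
    moreover have "finsum (row_module n) f A = (\<lambda>k. \<Sum>a\<in>A. f a k)"
      using insert by auto
    ultimately show ?case using insert(1,2) by (simp add: row_module_def)
  qed
qed

text \<open>For finite \<open>L\<close> the support condition is automatic, vanishing components may
  be added to the sum, and sums of rows are taken coordinatewise.\<close>

lemma internal_direct_sum_row_module:
  assumes "ring (ring_of_type_algebra :: 'r::ring_1 ring)" and "finite L"
  shows "internal_direct_sum (ring_of_type_algebra :: 'r ring) (row_module n) L N \<longleftrightarrow>
    (\<forall>l\<in>L. submodule (N l) (ring_of_type_algebra :: 'r ring) (row_module n)) \<and>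
    (\<forall>x. (\<forall>k\<ge>n. x k = 0) \<longrightarrow> (\<exists>!f. f \<in> (\<Pi>\<^sub>E l\<in>L. N l) \<and> (\<forall>k. x k = (\<Sum>l\<in>L. f l k))))"
proof -
  let ?R = "ring_of_type_algebra :: 'r ring" and ?M = "row_module n :: ('r, nat \<Rightarrow> 'r) module"
  have "(f \<in> (\<Pi>\<^sub>E l\<in>L. N l) \<and> finite {l \<in> L. f l \<noteq> \<zero>\<^bsub>?M\<^esub>} \<and>
        x = (\<Oplus>\<^bsub>?M\<^esub>l\<in>{l \<in> L. f l \<noteq> \<zero>\<^bsub>?M\<^esub>}. f l)) \<longleftrightarrow>
      (f \<in> (\<Pi>\<^sub>E l\<in>L. N l) \<and> (\<forall>k. x k = (\<Sum>l\<in>L. f l k)))"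
    if sub: "\<forall>l\<in>L. submodule (N l) ?R ?M" for f x
  proof (cases "f \<in> (\<Pi>\<^sub>E l\<in>L. N l)")
    case True
    have "f l k = 0" if "l \<in> L" "k \<ge> n" for l k
      using submodule_row_moduleD(1)[of "N l"] sub that PiE_mem[OF True] by blast
    then have "(\<Oplus>\<^bsub>?M\<^esub>l\<in>{l \<in> L. f l \<noteq> \<zero>\<^bsub>?M\<^esub>}. f l)
        = (\<lambda>k. \<Sum>l\<in>{l \<in> L. f l \<noteq> \<zero>\<^bsub>?M\<^esub>}. f l k)"
      using assms by (intro finsum_row_module) auto
    also have "\<dots> = (\<lambda>k. \<Sum>l\<in>L. f l k)"
      using assms(2) by (intro ext sum.mono_neutral_left) (auto simp: row_module_def)
    finally show ?thesis using assms(2) by (auto simp: fun_eq_iff)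
  qed auto
  moreover have "carrier ?M = {x. \<forall>k\<ge>n. x k = 0}" by (simp add: row_module_def)
  ultimately show ?thesis
    unfolding internal_direct_sum_def
    by (intro conj_cong refl) simp
qed

text \<open>Since \<open>w u = 1\<close>, the map \<open>m\<close> from \<open>r\<close> to
  \<open>r w\<close> is split by multiplication with \<open>u\<close>. Thus \<open>M' = R w\<close>
  is a copy of the regular module with complement \<open>Y\<close>, and exchanging it against the
  coordinate summands produces the left ideals of
  \<open>left_ideal_complement_idempotents\<close>.\<close>

lemma exchange_ring_idempotents:
  fixes w u :: "nat \<Rightarrow> 'r::ring_1"
  assumes ex: "exchange_ring (ring_of_type_algebra :: 'r ring)" and wu: "(\<Sum>k<n. w k * u k) = 1"
  obtains c where "\<And>k. k < n \<Longrightarrow> w k * c k * (w k * c k) = w k * c k"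
    and "(\<Sum>k<n. w k * c k) = 1"
proof -
  let ?R = "ring_of_type_algebra :: 'r ring" and ?A = "row_module n :: ('r, nat \<Rightarrow> 'r) module"
  have ring: "ring ?R" using ex by (simp add: exchange_ring_def)
  define m where "m r = (\<lambda>k. if k < n then r * w k else 0)" for r
  define e :: "nat \<Rightarrow> nat \<Rightarrow> 'r" where "e k = (\<lambda>j. if j = k then 1 else 0)" for k
  define M' where "M' = range m"
  define Y where "Y = {y :: nat \<Rightarrow> 'r. (\<forall>k\<ge>n. y k = 0) \<and> (\<Sum>k<n. y k * u k) = 0}"
  \<comment> \<open>The index set must consist of elements of the module's type, so a coordinate
    summand is indexed by its own unit row \<open>e k\<close>.\<close>
  define L where "L = e ` {..<n}"
  define N where "N l = range (\<lambda>r j. r * l j)" for l :: "nat \<Rightarrow> 'r"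
  have m_u: "(\<Sum>k<n. m r k * u k) = r" for r
  proof -
    have "(\<Sum>k<n. m r k * u k) = r * (\<Sum>k<n. w k * u k)"
      by (simp add: m_def sum_distrib_left mult.assoc)
    then show ?thesis using wu by simp
  qed
  then have inj_m: "inj m" by (metis injI)
  have inj_e: "inj_on e {..<n}"
    by (auto simp: inj_on_def e_def fun_eq_iff split: if_splits)
  have sum_L: "(\<Sum>l\<in>L. h l) = (\<Sum>k<n. h (e k))" for h :: "(nat \<Rightarrow> 'r) \<Rightarrow> 'r"
    by (simp add: L_def sum.reindex[OF inj_e])
  have m_ops: "(\<lambda>_. 0) = m 0" "(\<lambda>k. m r k + m s k) = m (r + s)" "(\<lambda>k. a * m r k) = m (a * r)"
    for r s a
    by (auto simp: m_def algebra_simps)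
  have sub_M': "submodule M' ?R ?A"
    by (rule submodule_row_moduleI[OF ring]) (auto simp: M'_def m_ops, simp add: m_def)
  have sub_Y: "submodule Y ?R ?A"
    by (rule submodule_row_moduleI[OF ring])
      (auto simp: Y_def sum.distrib distrib_right mult.assoc simp flip: sum_distrib_left)
  have N_ops: "(\<lambda>_. 0) \<in> N l" "x \<in> N l \<Longrightarrow> y \<in> N l \<Longrightarrow> (\<lambda>k. x k + y k) \<in> N l"
    "x \<in> N l \<Longrightarrow> (\<lambda>k. a * x k) \<in> N l" for l x y a
    unfolding N_def
  proof -
    show "(\<lambda>_. 0) \<in> range (\<lambda>r j. r * l j)" by (rule range_eqI[of _ _ 0]) simp
    show "(\<lambda>k. x k + y k) \<in> range (\<lambda>r j. r * l j)"
      if "x \<in> range (\<lambda>r j. r * l j)" "y \<in> range (\<lambda>r j. r * l j)"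
    proof -
      from that obtain r s where "x = (\<lambda>j. r * l j)" "y = (\<lambda>j. s * l j)" by blast
      then show ?thesis by (intro range_eqI[of _ _ "r + s"]) (simp add: distrib_right)
    qed
    show "(\<lambda>k. a * x k) \<in> range (\<lambda>r j. r * l j)" if "x \<in> range (\<lambda>r j. r * l j)"
    proof -
      from that obtain r where "x = (\<lambda>j. r * l j)" by blast
      then show ?thesis by (intro range_eqI[of _ _ "a * r"]) (simp add: mult.assoc)
    qed
  qed
  have sub_N: "submodule (N l) ?R ?A" if "l \<in> L" for l
    by (rule submodule_row_moduleI[OF ring]) (use that N_ops in \<open>auto simp: N_def L_def e_def\<close>)
  have iso: "module_iso_onto ?R (left_regular_module ?R) ?A M' m"
    using inj_m unfolding module_iso_onto_def bij_betw_def
    by (auto simp: left_regular_module_def ring_of_type_algebra_def row_module_def M'_def m_def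
      algebra_simps fun_eq_iff)
  have ids1: "internal_direct_sum ?R ?A UNIV (\<lambda>b. if b then M' else Y)"
    unfolding internal_direct_sum_row_module[OF ring finite]
  proof (intro conjI ballI allI impI)
    fix x :: "nat \<Rightarrow> 'r" assume x: "\<forall>k\<ge>n. x k = 0"
    \<comment> \<open>The projection onto \<open>M'\<close> along \<open>Y\<close> sends
      \<open>x\<close> to \<open>(x u) w\<close>. It is forced, because multiplying by
      \<open>u\<close> annihilates \<open>Y\<close> and recovers \<open>r\<close> from
      \<open>m r\<close>.\<close>
    let ?r = "\<Sum>k<n. x k * u k"
    show "\<exists>!f. f \<in> (\<Pi>\<^sub>E b\<in>UNIV. if b then M' else Y) \<and> (\<forall>k. x k = (\<Sum>b\<in>UNIV. f b k))"
    proof (rule ex1I[of _ "\<lambda>b k. if b then m ?r k else x k - m ?r k"], intro conjI PiE_I)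
      fix b :: bool
      show "(\<lambda>k. if b then m ?r k else x k - m ?r k) \<in> (if b then M' else Y)"
        using x m_u[of ?r] by (auto simp: M'_def Y_def left_diff_distrib sum_subtractf) (auto simp: m_def)
    next
      fix f assume f: "f \<in> (\<Pi>\<^sub>E b\<in>UNIV. if b then M' else Y) \<and> (\<forall>k. x k = (\<Sum>b\<in>UNIV. f b k))"
      have "f True \<in> M'" "f False \<in> Y" using PiE_mem[OF conjunct1[OF f], of True]
        PiE_mem[OF conjunct1[OF f], of False] by auto
      moreover have xf: "x k = f True k + f False k" for k
        using f by (simp add: UNIV_bool add.commute)
      ultimately obtain r where r: "f True = m r" and "?r = r"
        using m_u by (auto simp: M'_def Y_def distrib_right sum.distrib)
      then have "f b = (\<lambda>k. if b then m ?r k else x k - m ?r k)" for b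
        using xf by (cases b) (auto simp: fun_eq_iff)
      then show "f = (\<lambda>b k. if b then m ?r k else x k - m ?r k)" by blast
    qed (auto simp: UNIV_bool)
  qed (use sub_M' sub_Y in auto)
  have finL: "finite L" by (simp add: L_def)
  have ids2: "internal_direct_sum ?R ?A L N"
    unfolding internal_direct_sum_row_module[OF ring finL]
  proof (intro conjI ballI allI impI)
    fix x :: "nat \<Rightarrow> 'r" assume x: "\<forall>k\<ge>n. x k = 0"
    show "\<exists>!f. f \<in> (\<Pi>\<^sub>E l\<in>L. N l) \<and> (\<forall>k. x k = (\<Sum>l\<in>L. f l k))"
    \<comment> \<open>Multiplying coordinatewise by the unit row \<open>l\<close> keeps one
      coordinate of \<open>x\<close>, which is its component in \<open>N l\<close>.\<close>
    proof (rule ex1I[of _ "\<lambda>l\<in>L. \<lambda>j. x j * l j"], intro conjI PiE_I allI)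
      fix l assume "l \<in> L"
      then obtain k where k: "l = e k" by (auto simp: L_def)
      have "(\<lambda>j. x j * l j) = (\<lambda>j. x k * l j)" by (auto simp: k e_def)
      then show "(\<lambda>l\<in>L. \<lambda>j. x j * l j) l \<in> N l" using \<open>l \<in> L\<close> by (auto simp: N_def)
    next
      fix k
      have "(\<Sum>l\<in>L. (\<lambda>l\<in>L. \<lambda>j. x j * l j) l k) = (\<Sum>l\<in>L. x k * l k)" by simp
      also have "\<dots> = (\<Sum>i<n. x k * e i k)" by (rule sum_L)
      also have "\<dots> = x k" using x by (simp add: e_def if_distrib sum.delta cong: if_cong)
      finally show "x k = (\<Sum>l\<in>L. (\<lambda>l\<in>L. \<lambda>j. x j * l j) l k)" by simp
    next
      fix f assume f: "f \<in> (\<Pi>\<^sub>E l\<in>L. N l) \<and> (\<forall>k. x k = (\<Sum>l\<in>L. f l k))"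
      have fe: "f (e k) j = 0" if "k < n" "j \<noteq> k" for k j
        using PiE_mem[OF conjunct1[OF f], of "e k"] that by (auto simp: L_def N_def e_def)
      have "f l j = x j * l j" if l: "l \<in> L" for l j
      proof -
        obtain k where k: "k < n" "l = e k" using l by (auto simp: L_def)
        show ?thesis
        proof (cases "j = k")
          case True
          have "x k = (\<Sum>i<n. f (e i) k)" using f sum_L[of "\<lambda>l. f l k"] by simp
          also have "\<dots> = (\<Sum>i\<in>{k}. f (e i) k)"
            using k fe by (intro sum.mono_neutral_right) auto
          finally show ?thesis using True by (simp add: k e_def)
        qed (use fe k in \<open>simp add: e_def\<close>)
      qed
      then show "f = (\<lambda>l\<in>L. \<lambda>j. x j * l j)"
        using f by (intro ext) (auto simp: PiE_def extensional_def fun_eq_iff)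
    qed auto
  qed (use sub_N in auto)
  obtain N' where N': "\<And>l. l \<in> L \<Longrightarrow> submodule (N' l) ?R ?A" "\<And>l. l \<in> L \<Longrightarrow> N' l \<subseteq> N l"
      and ids: "internal_direct_sum ?R ?A (insert None (Some ` L)) (case_option M' N')"
  proof -
    have "\<forall>(A :: ('r, nat \<Rightarrow> 'r) module) M' Y (L :: (nat \<Rightarrow> 'r) set) N.
      left_module ?R A \<and> (\<exists>f. module_iso_onto ?R (left_regular_module ?R) A M' f) \<and>
      internal_direct_sum ?R A UNIV (\<lambda>b. if b then M' else Y) \<and> internal_direct_sum ?R A L N \<longrightarrow>
      (\<exists>N'. (\<forall>l\<in>L. submodule (N' l) ?R A \<and> N' l \<subseteq> N l) \<and>
            internal_direct_sum ?R A (insert None (Some ` L)) (case_option M' N'))"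
      using ex unfolding exchange_ring_def exchange_property_def by (rule conjunct2)
    moreover have "\<exists>f. module_iso_onto ?R (left_regular_module ?R) ?A M' f"
      using iso by blast
    ultimately have "\<exists>N'. (\<forall>l\<in>L. submodule (N' l) ?R ?A \<and> N' l \<subseteq> N l) \<and>
        internal_direct_sum ?R ?A (insert None (Some ` L)) (case_option M' N')"
      using left_module_row_module[OF ring] ids1 ids2 by simp
    then show thesis using that by blast
  qed
  let ?O = "insert None (Some ` L)"
  have finO: "finite ?O" using finL by simp
  have sum_O: "(\<Sum>l\<in>?O. h l) = h None + (\<Sum>k<n. h (Some (e k)))" for h :: "_ \<Rightarrow> 'r"
    by (subst sum.insert) (auto simp: finL sum.reindex sum_L)
  have unique: "\<exists>!f. f \<in> (\<Pi>\<^sub>E l\<in>?O. case_option M' N' l) \<and> (\<forall>k. x k = (\<Sum>l\<in>?O. f l k))"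
    if "\<forall>k\<ge>n. x k = 0" for x
    using conjunct2[OF iffD1[OF internal_direct_sum_row_module[OF ring finO] ids]] that
    by (drule_tac spec[of _ x]) (erule mp)
  \<comment> \<open>For \<open>k < n\<close>, \<open>N' (e k)\<close> lies in
    \<open>R e\<^sub>k\<close> and is therefore given by its coefficients, a left ideal
    \<open>J k\<close>.\<close>
  define J where "J k = {s. (\<lambda>j. s * e k j) \<in> N' (e k)}" for k
  have N'_e: "y j = y k * e k j" if "y \<in> N' (e k)" "k < n" for y k j
    using that N'(2)[of "e k"] by (auto simp: L_def N_def e_def)
  \<comment> \<open>Decompose \<open>e k\<close> along \<open>M'\<close> and the
    \<open>N' l\<close>. The part in \<open>M'\<close> is \<open>c w\<close>, and each coordinate of
    \<open>e k - c w\<close> is the coefficient of a single component, so it lies in the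
    corresponding \<open>J l\<close>.\<close>
  have "\<exists>c. (\<forall>l<n. l \<noteq> k \<longrightarrow> c * w l \<in> J l) \<and> 1 - c * w k \<in> J k" if k: "k < n" for k
  proof -
    obtain f where f: "f \<in> (\<Pi>\<^sub>E l\<in>?O. case_option M' N' l)" "\<And>j. e k j = (\<Sum>l\<in>?O. f l j)"
      using ex1_implies_ex[OF unique[of "e k"]] k by (auto simp: e_def)
    obtain c where c: "f None = m c" using PiE_mem[OF f(1), of None] by (auto simp: M'_def)
    have fN': "f (Some (e l)) \<in> N' (e l)" if "l < n" for l
      using PiE_mem[OF f(1), of "Some (e l)"] that by (auto simp: L_def)
    have fJ: "f (Some (e l)) l \<in> J l" if "l < n" for l
    proof -
      have "f (Some (e l)) = (\<lambda>j. f (Some (e l)) l * e l j)" using N'_e[OF fN'] that by blast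
      then show ?thesis using fN'[OF that] by (simp add: J_def)
    qed
    have f_off: "f (Some (e i)) j = 0" if "i < n" "j \<noteq> i" for i j
      using N'_e[OF fN'[OF that(1)] that(1), of j] that(2) by (simp add: e_def)
    have eq: "e k l = c * w l + f (Some (e l)) l" if l: "l < n" for l
    proof -
      have "(\<Sum>i<n. f (Some (e i)) l) = (\<Sum>i\<in>{l}. f (Some (e i)) l)"
        using l f_off by (intro sum.mono_neutral_right) auto
      then show ?thesis using f(2)[of l] l by (simp add: sum_O c m_def)
    qed
    have "c * w l \<in> J l" if "l < n" "l \<noteq> k" for l
    proof -
      have "c * w l = - 1 * f (Some (e l)) l"
        using eq[OF that(1)] that(2) by (simp add: e_def add_eq_0_iff)
      then show ?thesis
        using fJ[OF that(1)] submodule_row_moduleD(4)[OF N'(1), of "e l" _ "- 1"] that(1)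
        by (simp add: J_def L_def)
    qed
    moreover have "1 - c * w k \<in> J k"
    proof -
      have "1 - c * w k = f (Some (e k)) k"
        using eq[OF k] by (simp add: e_def diff_eq_eq add.commute)
      then show ?thesis using fJ[OF k] by simp
    qed
    ultimately show ?thesis by blast
  qed
  then obtain c where c: "\<And>k l. k < n \<Longrightarrow> l < n \<Longrightarrow> l \<noteq> k \<Longrightarrow> c k * w l \<in> J l"
      "\<And>k. k < n \<Longrightarrow> 1 - c k * w k \<in> J k"
    by metis
  have indep: "r = 0" if r: "\<And>l. l < n \<Longrightarrow> r * w l \<in> J l" for r
  proof -
    \<comment> \<open>If \<open>r w\<close> has all coordinates in the \<open>J l\<close>, then
      \<open>- r w\<close> in \<open>M'\<close> together with the coordinate parts of
      \<open>r w\<close> decomposes the zero row. Uniqueness identifies this with the trivial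
      decomposition \<open>z\<close>.\<close>
    define g where "g = (\<lambda>l\<in>?O. case l of None \<Rightarrow> m (- r) | Some l \<Rightarrow> (\<lambda>j. m r j * l j))"
    have g: "g \<in> (\<Pi>\<^sub>E l\<in>?O. case_option M' N' l)"
    proof -
      have "(\<lambda>j. m r j * e k j) \<in> N' (e k)" if "k < n" for k
      proof -
        have "(\<lambda>j. m r j * e k j) = (\<lambda>j. r * w k * e k j)" using that by (auto simp: e_def m_def)
        then show ?thesis using r[OF that] by (simp add: J_def)
      qed
      then show ?thesis by (auto simp: g_def M'_def L_def)
    qed
    have g0: "(\<Sum>l\<in>?O. g l k) = 0" for k
    proof -
      have "(\<Sum>l\<in>?O. g l k) = m (- r) k + (\<Sum>i<n. m r k * e i k)"
        unfolding sum_O by (auto simp: g_def L_def intro!: sum.cong)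
      also have "(\<Sum>i<n. m r k * e i k) = m r k"
        by (simp add: e_def if_distrib sum.delta m_def cong: if_cong)
      finally show ?thesis by (simp add: m_def)
    qed
    define z :: "_ \<Rightarrow> nat \<Rightarrow> 'r" where "z = (\<lambda>l\<in>?O. \<lambda>_. 0)"
    have z: "z \<in> (\<Pi>\<^sub>E l\<in>?O. case_option M' N' l)"
      using submodule_row_moduleD(2)[OF sub_M'] submodule_row_moduleD(2)[OF N'(1)]
      by (auto simp: z_def)
    have z0: "(\<Sum>l\<in>?O. z l k) = 0" for k by (simp add: z_def)
    obtain h where h: "f = h" if "f \<in> (\<Pi>\<^sub>E l\<in>?O. case_option M' N' l)" "\<forall>k. 0 = (\<Sum>l\<in>?O. f l k)" for f
      using ex1E[OF unique[of "\<lambda>_. 0", OF allI[OF impI[OF refl]]]] by metis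
    have "g = z" using h[OF g] h[OF z] g0 z0 by simp
    then have "g None = z None" by simp
    then have "m (- r) = m 0" unfolding m_ops(1)[symmetric] by (simp add: g_def z_def)
    then show "r = 0" using inj_m by (auto dest: injD)
  qed
  have J: "a + b \<in> J k" "s * a \<in> J k" "0 \<in> J k" if "k < n" "a \<in> J k" "b \<in> J k" for k a b s
    using that submodule_row_moduleD[OF N'(1), of "e k"]
    by (auto simp: J_def L_def distrib_right mult.assoc)
  have J0: "0 \<in> J k" if "k < n" for k
    using that submodule_row_moduleD(2)[OF N'(1), of "e k"] by (auto simp: J_def L_def)
  show ?thesis
    by (rule that; rule left_ideal_complement_idempotents[of n J c w]; (rule J0 c indep | blast intro: J))
qed

subsection \<open>Matrices of the form identity plus column times row\<close>

definition id_outer :: "nat \<Rightarrow> (nat \<Rightarrow> 'r::ring_1) \<Rightarrow> (nat \<Rightarrow> 'r) \<Rightarrow> 'r mat" where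
  "id_outer n y z = mat n n (\<lambda>(a, b). (if a = b then 1 else 0) + y a * z b)"

definition single :: "nat \<Rightarrow> 'r::ring_1 \<Rightarrow> nat \<Rightarrow> 'r" where
  "single k x = (\<lambda>a. if a = k then x else 0)"

lemma single_same [simp]: "single k x k = x" and single_diff [simp]: "a \<noteq> k \<Longrightarrow> single k x a = 0"
  by (simp_all add: single_def)

lemma id_outer_carrier [simp]: "id_outer n y z \<in> carrier_mat n n"
  by (simp add: id_outer_def)

lemma id_outer_cong:
  assumes "\<And>a. a < n \<Longrightarrow> y a = y' a" "\<And>a. a < n \<Longrightarrow> z a = z' a"
  shows "id_outer n y z = id_outer n y' z'"
  using assms by (auto simp: id_outer_def)

lemma transvection_eq_id_outer:
  "i < n \<Longrightarrow> j < n \<Longrightarrow> i \<noteq> j \<Longrightarrow> transvection n i j x = id_outer n (single i x) (single j 1)"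
  by (rule eq_matI) (auto simp: transvection_def matrix_unit_def id_outer_def single_def)

lemma id_outer_zero [simp]: "id_outer n (\<lambda>_. 0) z = 1\<^sub>m n" "id_outer n y (\<lambda>_. 0) = 1\<^sub>m n"
  by (auto simp: id_outer_def)

text \<open>The product of the two rank-one terms contains the scalar \<open>z y'\<close> in the
  middle. Once it vanishes, matrices with a common row multiply by adding columns, and those with a
  common column by adding rows.\<close>

lemma id_outer_mult:
  "id_outer n y z * id_outer n y' z' = mat n n (\<lambda>(a, b). (if a = b then 1 else 0) + y a * z b + y' a * z' b
     + y a * (\<Sum>k<n. z k * y' k) * z' b)" (is "_ = ?M")
proof (rule eq_matI)
  fix a b assume "a < dim_row (?M)" "b < dim_col (?M)"
  then have ab: "a < n" "b < n" by auto
  have "(\<Sum>k<n. ((if a = k then 1 else 0) + y a * z k) * ((if k = b then 1 else 0) + y' k * z' b))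
    = (\<Sum>k<n. (if k = a then (if k = b then 1 else 0) + y' k * z' b else 0)
        + (if k = b then y a * z k else 0) + y a * (z k * y' k) * z' b)"
    by (intro sum.cong) (auto simp: algebra_simps)
  also have "\<dots> = (if a = b then 1 else 0) + y a * z b + y' a * z' b
     + y a * (\<Sum>k<n. z k * y' k) * z' b"
    using ab by (simp add: sum.distrib sum.delta sum_distrib_left sum_distrib_right)
  finally show "(id_outer n y z * id_outer n y' z') $$ (a, b) = ?M $$ (a, b)"
    using ab by (simp add: id_outer_def scalar_prod_def lessThan_atLeast0)
qed (auto simp: id_outer_def)

lemma id_outer_mult_same_right:
  assumes "(\<Sum>k<n. z k * y' k) = 0"
  shows "id_outer n y z * id_outer n y' z = id_outer n (\<lambda>a. y a + y' a) z"
  unfolding id_outer_mult assms by (auto simp: id_outer_def algebra_simps)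

lemma id_outer_mult_same_left:
  assumes "(\<Sum>k<n. z k * y k) = 0"
  shows "id_outer n y z * id_outer n y z' = id_outer n y (\<lambda>a. z a + z' a)"
  unfolding id_outer_mult assms by (auto simp: id_outer_def algebra_simps)

text \<open>The identity summand contributes \<open>g h = 1\<close>, while \<open>g\<close> acts on
  the column and \<open>h\<close> on the row. It serves for conjugation by general invertible
  matrices and by elementary ones.\<close>

lemma id_outer_conjugate:
  assumes g: "g \<in> carrier_mat n n" and h: "h \<in> carrier_mat n n" and gh: "g * h = 1\<^sub>m n"
  shows "g * id_outer n y z * h = id_outer n (\<lambda>a. \<Sum>k<n. g $$ (a, k) * y k) (\<lambda>b. \<Sum>k<n. z k * h $$ (k, b))"
    (is "_ = id_outer n ?y ?z")
proof -
  have ghs: "(\<Sum>k<n. g $$ (a, k) * h $$ (k, b)) = (if a = b then 1 else 0)" if "a < n" "b < n" for a b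
    using arg_cong[OF gh, of "\<lambda>A. A $$ (a, b)"] that g h
    by (auto simp: scalar_prod_def lessThan_atLeast0)
  have gop: "(g * id_outer n y z) $$ (a, k) = g $$ (a, k) + ?y a * z k" if "a < n" "k < n" for a k
  proof -
    have "(g * id_outer n y z) $$ (a, k)
      = (\<Sum>l<n. g $$ (a, l) * ((if l = k then 1 else 0) + y l * z k))"
      using that g by (auto simp: scalar_prod_def lessThan_atLeast0 id_outer_def)
    also have "\<dots> = (\<Sum>l<n. (if l = k then g $$ (a, l) else 0) + g $$ (a, l) * y l * z k)"
      by (intro sum.cong) (auto simp: algebra_simps)
    finally show ?thesis using that by (simp add: sum.distrib sum.delta sum_distrib_right)
  qed
  show ?thesis
  proof (rule eq_matI)
    fix a b assume "a < dim_row (id_outer n ?y ?z)" "b < dim_col (id_outer n ?y ?z)"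
    then have ab: "a < n" "b < n" by (auto simp: id_outer_def)
    have "(g * id_outer n y z * h) $$ (a, b) = (\<Sum>k<n. (g * id_outer n y z) $$ (a, k) * h $$ (k, b))"
      using ab g h by (auto simp: scalar_prod_def lessThan_atLeast0 id_outer_def)
    also have "\<dots> = (\<Sum>k<n. g $$ (a, k) * h $$ (k, b) + ?y a * (z k * h $$ (k, b)))"
      using ab by (intro sum.cong) (auto simp: gop algebra_simps)
    also have "\<dots> = id_outer n ?y ?z $$ (a, b)"
      using ab by (simp add: id_outer_def sum.distrib ghs flip: sum_distrib_left)
    finally show "(g * id_outer n y z * h) $$ (a, b) = id_outer n ?y ?z $$ (a, b)" .
  qed (use g h in \<open>auto simp: id_outer_def\<close>)
qed

lemma sum_single [simp]:
  "k < n \<Longrightarrow> (\<Sum>a<n. single k x a * f a) = x * f k"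
  "k < n \<Longrightarrow> (\<Sum>a<n. f a * single k x a) = f k * x"
  by (simp_all add: single_def if_distrib if_distribR sum.delta cong: if_cong)

text \<open>\<open>E\<close> and \<open>N\<close> stand for \<open>E\<^sub>n(R)\<close> and \<open>E\<^sub>n(R, I)\<close>.\<close>

locale elementary_normal =
  fixes n :: nat and I :: "'r::ring_1 set" and E N :: "'r mat set"
  assumes I_zero: "0 \<in> I" and I_add: "x \<in> I \<Longrightarrow> y \<in> I \<Longrightarrow> x + y \<in> I"
    and I_lmult: "x \<in> I \<Longrightarrow> r * x \<in> I" and I_rmult: "x \<in> I \<Longrightarrow> x * r \<in> I"
    and E_one: "1\<^sub>m n \<in> E" and E_mult: "A \<in> E \<Longrightarrow> B \<in> E \<Longrightarrow> A * B \<in> E"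
    and E_transvection: "i < n \<Longrightarrow> j < n \<Longrightarrow> i \<noteq> j \<Longrightarrow> transvection n i j r \<in> E"
    and N_one: "1\<^sub>m n \<in> N" and N_mult: "A \<in> N \<Longrightarrow> B \<in> N \<Longrightarrow> A * B \<in> N"
    and N_transvection: "i < n \<Longrightarrow> j < n \<Longrightarrow> i \<noteq> j \<Longrightarrow> x \<in> I \<Longrightarrow> transvection n i j x \<in> N"
    and N_conj: "A \<in> N \<Longrightarrow> B \<in> E \<Longrightarrow> C \<in> E \<Longrightarrow> B * C = 1\<^sub>m n \<Longrightarrow> C * B = 1\<^sub>m n \<Longrightarrow> B * A * C \<in> N"
begin

section \<open>Membership of such matrices in the elementary subgroups\<close>

lemma I_sum: "(\<And>k. k \<in> A \<Longrightarrow> f k \<in> I) \<Longrightarrow> (\<Sum>k\<in>A. f k) \<in> I"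
  by (induction A rule: infinite_finite_induct) (auto intro: I_zero I_add)

lemma I_minus: "x \<in> I \<Longrightarrow> - x \<in> I"
  using I_lmult[of x "- 1"] by simp

text \<open>The matrix is the product of the transvections at \<open>(k, b)\<close> with entry
  \<open>z b\<close>, \<open>b \<noteq> k\<close>: they share their column, all cross terms vanish,
  and the rows add up. The induction fills in one position at a time.\<close>

lemma id_outer_row_in_E:
  assumes k: "k < n" and "z k = 0"
  shows "id_outer n (single k 1) z \<in> E"
proof -
  have "id_outer n (single k 1) (\<lambda>a. if a \<in> A then z a else 0) \<in> E" if "finite A" "A \<subseteq> {..<n} - {k}" for A
    using that
  proof (induction A rule: finite_induct)
    case empty
    then show ?case by (simp add: E_one)
  next
    case (insert b A)
    let ?z = "\<lambda>a. if a \<in> A then z a else 0"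
    have "id_outer n (single k 1) (single b (z b)) = id_outer n (single k (z b)) (single b 1)"
      by (auto simp: id_outer_def single_def)
    also have "\<dots> = transvection n k b (z b)" using k insert by (subst transvection_eq_id_outer) auto
    also have "\<dots> \<in> E" using k insert by (intro E_transvection) auto
    finally have "id_outer n (single k 1) (single b (z b)) * id_outer n (single k 1) ?z \<in> E"
      using insert by (intro E_mult) auto
    also have "id_outer n (single k 1) (single b (z b)) * id_outer n (single k 1) ?z
       = id_outer n (single k 1) (\<lambda>a. single b (z b) a + ?z a)"
      by (rule id_outer_mult_same_left) (use insert k in auto)
    also have "(\<lambda>a. single b (z b) a + ?z a) = (\<lambda>a. if a \<in> insert b A then z a else 0)"
      using insert by (auto simp: single_def)
    finally show ?case .
  qed
  from this[of "{..<n} - {k}"] have "id_outer n (single k 1) (\<lambda>a. if a \<in> {..<n} - {k} then z a else 0) \<in> E"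
    by simp
  also have "id_outer n (single k 1) (\<lambda>a. if a \<in> {..<n} - {k} then z a else 0) = id_outer n (single k 1) z"
    using assms by (intro id_outer_cong) auto
  finally show ?thesis .
qed

text \<open>The transposed argument, with all transvections of level \<open>I\<close>.\<close>

lemma id_outer_column_in_N:
  assumes k: "k < n" and "y k = 0" and yI: "\<And>a. a < n \<Longrightarrow> y a \<in> I"
  shows "id_outer n y (single k 1) \<in> N"
proof -
  have "id_outer n (\<lambda>a. if a \<in> A then y a else 0) (single k 1) \<in> N" if "finite A" "A \<subseteq> {..<n} - {k}" for A
    using that
  proof (induction A rule: finite_induct)
    case empty
    then show ?case by (simp add: N_one)
  next
    case (insert b A)
    let ?y = "\<lambda>a. if a \<in> A then y a else 0"
    have "id_outer n (single b (y b)) (single k 1) = transvection n b k (y b)"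
      using k insert by (subst transvection_eq_id_outer) auto
    also have "\<dots> \<in> N" using k insert yI by (intro N_transvection) auto
    finally have "id_outer n (single b (y b)) (single k 1) * id_outer n ?y (single k 1) \<in> N"
      using insert by (intro N_mult) auto
    also have "id_outer n (single b (y b)) (single k 1) * id_outer n ?y (single k 1)
       = id_outer n (\<lambda>a. single b (y b) a + ?y a) (single k 1)"
      by (rule id_outer_mult_same_right) (use insert k in auto)
    also have "(\<lambda>a. single b (y b) a + ?y a) = (\<lambda>a. if a \<in> insert b A then y a else 0)"
      using insert by (auto simp: single_def)
    finally show ?case .
  qed
  from this[of "{..<n} - {k}"] have "id_outer n (\<lambda>a. if a \<in> {..<n} - {k} then y a else 0) (single k 1) \<in> N"
    by simp
  also have "id_outer n (\<lambda>a. if a \<in> {..<n} - {k} then y a else 0) (single k 1) = id_outer n y (single k 1)"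
    using assms by (intro id_outer_cong) auto
  finally show ?thesis .
qed

text \<open>The matrix is the transvection at \<open>(k, l)\<close> with entry \<open>y\<close>
  times the conjugate of its inverse by the transvection at \<open>(l, k)\<close> with entry
  \<open>z\<close>. Both factors lie in \<open>N\<close>.\<close>

lemma id_outer_diagonal_in_N:
  assumes "k < n" "l < n" "l \<noteq> k" and y: "y \<in> I" and zy: "z * y = 0"
  shows "id_outer n (single k y) (single k z) \<in> N"
proof -
  let ?t = "\<lambda>s. transvection n l k s"
  have t: "?t s = id_outer n (single l s) (single k 1)" for s
    using assms by (intro transvection_eq_id_outer) auto
  have tt: "?t s * ?t (- s) = 1\<^sub>m n" for s
  proof -
    have "?t s * ?t (- s) = id_outer n (\<lambda>a. single l s a + single l (- s) a) (single k 1)"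
      unfolding t by (rule id_outer_mult_same_right) (use assms in auto)
    also have "(\<lambda>a. single l s a + single l (- s) a) = (\<lambda>_. 0)" by (auto simp: single_def)
    finally show ?thesis by simp
  qed
  have "?t z * transvection n k l (- y) * ?t (- z) \<in> N"
    using assms tt[of z] tt[of "- z"]
    by (intro N_conj N_transvection E_transvection I_minus) auto
  \<comment> \<open>The left factor would add \<open>- z * y\<close> to the column at position
    \<open>l\<close>, which is zero by \<open>zy\<close>. The right factor turns the row
    \<open>single l 1\<close> into \<open>single l 1 - single k z\<close>.\<close>
  also have "?t z * transvection n k l (- y) * ?t (- z)
      = id_outer n (single k (- y)) (\<lambda>b. single l 1 b + single k (- z) b)"
  proof -
    have "?t z * transvection n k l (- y) * ?t (- z) =
       id_outer n (\<lambda>a. \<Sum>b<n. ?t z $$ (a, b) * single k (- y) b) (\<lambda>b. \<Sum>a<n. single l 1 a * ?t (- z) $$ (a, b))"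
      unfolding transvection_eq_id_outer[OF assms(1,2) assms(3)[symmetric]]
      by (rule id_outer_conjugate) (use tt[of z] in \<open>auto simp: t\<close>)
    also have "\<dots> = id_outer n (single k (- y)) (\<lambda>b. single l 1 b + single k (- z) b)"
      using assms by (intro id_outer_cong) (auto simp: t, auto simp: id_outer_def single_def zy)
    finally show ?thesis .
  qed
  \<comment> \<open>Moving the sign from the column to the row gives both factors the column
    \<open>single k y\<close>; their rows then add up to \<open>single k z\<close>.\<close>
  also have "\<dots> = id_outer n (single k y) (\<lambda>b. single k z b - single l 1 b)"
    unfolding id_outer_def by (rule cong_mat) (auto simp: single_def algebra_simps)
  finally have "transvection n k l y * id_outer n (single k y) (\<lambda>b. single k z b - single l 1 b) \<in> N"
    using assms by (intro N_mult N_transvection) auto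
  also have "transvection n k l y * id_outer n (single k y) (\<lambda>b. single k z b - single l 1 b)
      = id_outer n (single k y) (\<lambda>b. single l 1 b + (single k z b - single l 1 b))"
    using assms by (simp add: transvection_eq_id_outer id_outer_mult_same_left)
  finally show ?thesis by simp
qed

text \<open>Splitting \<open>y\<close> into its \<open>k\<close>-th entry and the rest factors the
  matrix into a product of transvections and a diagonal matrix, as the cross term contains
  \<open>z * y k = 0\<close>. The bound \<open>n \<ge> 2\<close> provides the second index for the
  commutator.\<close>

lemma id_outer_column_orthogonal_in_N:
  assumes n: "n \<ge> 2" and k: "k < n" and yI: "\<And>a. a < n \<Longrightarrow> y a \<in> I" and zy: "z * y k = 0"
  shows "id_outer n y (single k z) \<in> N"
proof -
  obtain l where l: "l < n" "l \<noteq> k"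
    using n by (metis One_nat_def less_2_cases_iff less_le_trans zero_neq_one)
  have "id_outer n (\<lambda>a. if a = k then 0 else y a * z) (single k 1) * id_outer n (single k (y k)) (single k z) \<in> N"
    using k l yI zy
    by (intro N_mult id_outer_column_in_N id_outer_diagonal_in_N[of k l]) (auto intro: I_zero I_rmult)
  \<comment> \<open>The scalar \<open>z\<close> moves from the column to the row, so that both
    factors have the row \<open>single k z\<close>.\<close>
  also have "id_outer n (\<lambda>a. if a = k then 0 else y a * z) (single k 1)
      = id_outer n (\<lambda>a. if a = k then 0 else y a) (single k z)"
    by (auto simp: id_outer_def single_def)
  also have "\<dots> * id_outer n (single k (y k)) (single k z)
      = id_outer n (\<lambda>a. (if a = k then 0 else y a) + single k (y k) a) (single k z)"
    using k zy by (intro id_outer_mult_same_right) auto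
  also have "\<dots> = id_outer n y (single k z)"
    by (rule id_outer_cong) (auto simp: single_def)
  finally show ?thesis .
qed

text \<open>With \<open>q = 1 + e\<^sub>k r\<close> the row factors as
  \<open>z = z\<^sub>k e\<^sub>k q\<close>. Hence conjugating \<open>1 + y z\<close> by the
  elementary matrix \<open>q\<close> leaves a matrix that differs from the identity in column
  \<open>k\<close> only.\<close>

lemma id_outer_orthogonal_in_N:
  assumes n: "n \<ge> 2" and k: "k < n" and yI: "\<And>a. a < n \<Longrightarrow> y a \<in> I"
    and zy: "(\<Sum>a<n. z a * y a) = 0" and c: "\<And>l. l < n \<Longrightarrow> l \<noteq> k \<Longrightarrow> z l = z k * c l"
  shows "id_outer n y z \<in> N"
proof -
  define r where "r l = (if l = k then 0 else c l)" for l
  let ?q = "\<lambda>r. id_outer n (single k 1) r"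
  have rk: "r k = 0" by (simp add: r_def)
  have qq: "?q r * ?q (\<lambda>l. - r l) = 1\<^sub>m n" "?q (\<lambda>l. - r l) * ?q r = 1\<^sub>m n"
    using k rk by (auto simp: id_outer_mult_same_left sum_negf)
  \<comment> \<open>This is the column \<open>q y\<close>. Its product with
    \<open>z\<^sub>k e\<^sub>k\<close> is still \<open>z y = 0\<close>.\<close>
  define y' where "y' = (\<lambda>a. y a + single k (\<Sum>l<n. r l * y l) a)"
  have "z k * y' k = z k * y k + (\<Sum>l\<in>{..<n} - {k}. z l * y l)"
  proof -
    have "(\<Sum>l<n. r l * y l) = (\<Sum>l\<in>{..<n} - {k}. c l * y l)"
      using k by (subst sum.remove[of _ k]) (auto simp: r_def)
    then show ?thesis
      by (auto simp: y'_def single_def distrib_left sum_distrib_left c mult.assoc intro!: sum.cong)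
  qed
  also have "\<dots> = 0" using zy k by (subst (asm) sum.remove[of _ k]) auto
  finally have z'y': "z k * y' k = 0" .
  have y': "y' a \<in> I" if "a < n" for a
    using that yI unfolding y'_def single_def by (auto intro!: I_add I_zero I_sum I_lmult)
  have "id_outer n y' (single k (z k)) \<in> N"
    using n k y' z'y' by (rule id_outer_column_orthogonal_in_N)
  \<comment> \<open>Conjugating back turns \<open>q y\<close> into \<open>y\<close> and
    \<open>z\<^sub>k e\<^sub>k\<close> into \<open>z\<close>.\<close>
  then have "?q (\<lambda>l. - r l) * id_outer n y' (single k (z k)) * ?q r \<in> N"
    using k rk by (intro N_conj id_outer_row_in_E qq) auto
  also have "?q (\<lambda>l. - r l) * id_outer n y' (single k (z k)) * ?q r
     = id_outer n (\<lambda>a. \<Sum>b<n. ?q (\<lambda>l. - r l) $$ (a, b) * y' b) (\<lambda>b. \<Sum>a<n. single k (z k) a * ?q r $$ (a, b))"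
    by (intro id_outer_conjugate qq) auto
  also have "\<dots> = id_outer n y z"
  proof (rule id_outer_cong)
    fix a assume a: "a < n"
    have ry': "(\<Sum>b<n. r b * y' b) = (\<Sum>b<n. r b * y b)"
      by (intro sum.cong) (auto simp: y'_def single_def r_def)
    have "(\<Sum>b<n. ?q (\<lambda>l. - r l) $$ (a, b) * y' b)
       = (\<Sum>b<n. (if b = a then y' b else 0) - single k 1 a * (r b * y' b))"
      using a by (intro sum.cong) (auto simp: id_outer_def single_def algebra_simps)
    also have "\<dots> = y a"
      using a ry' by (simp add: sum_subtractf sum.delta y'_def single_def flip: sum_distrib_left)
    finally show "(\<Sum>b<n. ?q (\<lambda>l. - r l) $$ (a, b) * y' b) = y a" .
  next
    fix b assume b: "b < n"
    show "(\<Sum>a<n. single k (z k) a * ?q r $$ (a, b)) = z b"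
      using b k c[of b] by (simp add: id_outer_def) (auto simp: single_def r_def)
  qed
  finally show ?thesis .
qed

text \<open>As \<open>v y = 0\<close>, every left multiple of \<open>v\<close> is orthogonal to
  \<open>y\<close>, so the factors \<open>1 + y f\<^sub>k v\<close> multiply by adding their rows,
  and these sum to \<open>v\<close>.\<close>

lemma id_outer_unimodular_in_N:
  assumes n: "n \<ge> 2" and yI: "\<And>a. a < n \<Longrightarrow> y a \<in> I" and vy: "(\<Sum>a<n. v a * y a) = 0"
    and idem: "\<And>k. k < n \<Longrightarrow> v k * c k * (v k * c k) = v k * c k"
    and one: "(\<Sum>k<n. v k * c k) = 1"
  shows "id_outer n y v \<in> N"
proof -
  have "id_outer n y (\<lambda>a. (\<Sum>k\<in>A. v k * c k) * v a) \<in> N" if "finite A" "A \<subseteq> {..<n}" for A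
    using that
  proof (induction A rule: finite_induct)
    case empty
    then show ?case by (simp add: N_one)
  next
    case (insert k A)
    have orth: "(\<Sum>a<n. s * v a * y a) = 0" for s
      using vy by (simp add: mult.assoc flip: sum_distrib_left)
    have "id_outer n y (\<lambda>a. v k * c k * v a) \<in> N"
    proof (rule id_outer_orthogonal_in_N[where c = "\<lambda>l. c k * v l", OF n _ yI])
      fix l
      \<comment> \<open>Idempotency of \<open>v k * c k\<close> makes every entry of the row a right
        multiple of the \<open>k\<close>-th one.\<close>
      show "v k * c k * v l = v k * c k * v k * (c k * v l)"
        using arg_cong[OF idem[of k], of "\<lambda>s. s * v l"] insert by (simp only: mult.assoc) simp
    qed (use insert orth in auto)
    then have "id_outer n y (\<lambda>a. v k * c k * v a) * id_outer n y (\<lambda>a. (\<Sum>k\<in>A. v k * c k) * v a) \<in> N"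
      using insert by (intro N_mult) auto
    also have "id_outer n y (\<lambda>a. v k * c k * v a) * id_outer n y (\<lambda>a. (\<Sum>k\<in>A. v k * c k) * v a)
        = id_outer n y (\<lambda>a. v k * c k * v a + (\<Sum>k\<in>A. v k * c k) * v a)"
      using orth by (intro id_outer_mult_same_left)
    finally show ?case using insert by (simp add: distrib_right)
  qed
  from this[of "{..<n}"] show ?thesis using one by simp
qed

end

subsection \<open>Normal closures in subgroups\<close>

text \<open>Normality inside \<open>E\<close> is rephrased in terms of the operations of
  \<open>G\<close>, whose inverses agree with those of \<open>E\<close>.\<close>

lemma (in group) normal_closure_in_subgroup:
  assumes E: "subgroup E G" and T: "T \<subseteq> E"
  defines "N \<equiv> normal_closure (G\<lparr>carrier := E\<rparr>) (generate G T)"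
  shows "subgroup N G" "N \<subseteq> E" "generate G T \<subseteq> N"
    and "\<And>g h. g \<in> E \<Longrightarrow> h \<in> N \<Longrightarrow> g \<otimes> h \<otimes> inv g \<in> N"
    and "\<And>K. subgroup K G \<Longrightarrow> K \<subseteq> E \<Longrightarrow> T \<subseteq> K \<Longrightarrow>
      (\<And>g h. g \<in> E \<Longrightarrow> h \<in> K \<Longrightarrow> g \<otimes> h \<otimes> inv g \<in> K) \<Longrightarrow> N \<subseteq> K"
proof -
  let ?GE = "G\<lparr>carrier := E\<rparr>"
  interpret GE: group ?GE by (rule subgroup_imp_group[OF E])
  interpret E: subgroup E G by (rule E)
  have normal_iff: "K \<lhd> ?GE \<longleftrightarrow> subgroup K G \<and> K \<subseteq> E \<and> (\<forall>g\<in>E. \<forall>h\<in>K. g \<otimes> h \<otimes> inv g \<in> K)" for K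
  proof -
    have "subgroup K ?GE \<longleftrightarrow> subgroup K G \<and> K \<subseteq> E"
      using incl_subgroup[OF E] subgroup_incl[OF _ E] subgroup.subset[of K ?GE] by auto
    then show ?thesis
      using m_inv_consistent[OF E] by (auto simp: GE.normal_inv_iff)
  qed
  define F where "F = {K. K \<lhd> ?GE \<and> generate G T \<subseteq> K}"
  have N: "N = \<Inter> F" by (simp add: N_def normal_closure_def F_def)
  \<comment> \<open>The family is thus nonempty, which makes its intersection a subgroup contained
    in \<open>E\<close>.\<close>
  have "E \<in> F"
    using E T generate_subgroup_incl[OF T E] by (auto simp: F_def normal_iff)
  then show "subgroup N G" "N \<subseteq> E"
    unfolding N by (auto intro!: subgroups_Inter simp: F_def normal_iff)
  show "generate G T \<subseteq> N" "\<And>g h. g \<in> E \<Longrightarrow> h \<in> N \<Longrightarrow> g \<otimes> h \<otimes> inv g \<in> N"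
    unfolding N by (auto simp: F_def normal_iff)
  show "N \<subseteq> K" if "subgroup K G" "K \<subseteq> E" "T \<subseteq> K"
    "\<And>g h. g \<in> E \<Longrightarrow> h \<in> K \<Longrightarrow> g \<otimes> h \<otimes> inv g \<in> K" for K
    using that generate_subgroup_incl[OF that(3,1)] unfolding N by (auto simp: F_def normal_iff)
qed

text \<open>The elements of the closure all of whose conjugates under \<open>G\<close> stay in it
  form a subgroup \<open>K\<close> stable under \<open>G\<close>. As \<open>K\<close> contains
  \<open>T\<close>, minimality makes it the whole closure. Normality in \<open>G\<close> is thereby
  reduced to conjugates of the generators.\<close>

lemma (in group) normal_closure_in_subgroup_normal:
  assumes E: "subgroup E G" and T: "T \<subseteq> E"
    and conj: "\<And>g t. g \<in> carrier G \<Longrightarrow> t \<in> T \<Longrightarrow>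
      g \<otimes> t \<otimes> inv g \<in> normal_closure (G\<lparr>carrier := E\<rparr>) (generate G T)"
  shows "normal_closure (G\<lparr>carrier := E\<rparr>) (generate G T) \<lhd> G"
proof -
  define N where "N = normal_closure (G\<lparr>carrier := E\<rparr>) (generate G T)"
  note N = normal_closure_in_subgroup[OF E T, folded N_def]
  interpret N: subgroup N G by (rule N)
  interpret E: subgroup E G by (rule E)
  define K where "K = {h \<in> N. \<forall>g\<in>carrier G. g \<otimes> h \<otimes> inv g \<in> N}"
  have K: "subgroup K G"
  proof (rule subgroupI)
    show "K \<subseteq> carrier G" by (auto simp: K_def)
    show "K \<noteq> {}" by (auto simp: K_def intro!: exI[of _ \<one>])
  next
    fix a assume a: "a \<in> K"
    have "g \<otimes> inv a \<otimes> inv g = inv (g \<otimes> a \<otimes> inv g)" if "g \<in> carrier G" for g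
      using a that by (simp add: K_def inv_mult_group m_assoc)
    then show "inv a \<in> K" using a by (simp add: K_def)
  next
    fix a b assume ab: "a \<in> K" "b \<in> K"
    have "g \<otimes> (a \<otimes> b) \<otimes> inv g = (g \<otimes> a \<otimes> inv g) \<otimes> (g \<otimes> b \<otimes> inv g)" if "g \<in> carrier G" for g
    proof -
      have "inv g \<otimes> (g \<otimes> (b \<otimes> inv g)) = b \<otimes> inv g"
        using ab that by (simp add: K_def flip: m_assoc)
      then show ?thesis using ab that by (simp add: K_def m_assoc)
    qed
    then show "a \<otimes> b \<in> K" using ab by (simp add: K_def)
  qed
  have K_conj: "g \<otimes> h \<otimes> inv g \<in> K" if "g \<in> carrier G" "h \<in> K" for g h
  proof -
    have "g' \<otimes> (g \<otimes> h \<otimes> inv g) \<otimes> inv g' = (g' \<otimes> g) \<otimes> h \<otimes> inv (g' \<otimes> g)" if "g' \<in> carrier G" for g'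
      using that \<open>g \<in> carrier G\<close> \<open>h \<in> K\<close> by (simp add: K_def inv_mult_group m_assoc)
    then show ?thesis using that by (simp add: K_def)
  qed
  have "T \<subseteq> K"
    using conj N(3) generate.incl[of _ T G] by (auto simp: K_def N_def)
  then have "N \<subseteq> K"
    using K N(2) K_conj E.subset by (intro N(5)) (auto simp: K_def)
  then show ?thesis
    using N(1) by (auto simp: normal_inv_iff K_def simp flip: N_def)
qed

subsection \<open>Normality in the general linear group\<close>

lemma group_general_linear_group: "group (general_linear_group TYPE('r::ring_1) n)"
proof -
  interpret semiring "ring_mat TYPE('r) n ()" by (rule semiring_mat)
  show ?thesis unfolding general_linear_group_def by (rule units_group)
qed

lemma general_linear_group_simps:
  "carrier (general_linear_group TYPE('r::ring_1) n)
    = {A \<in> carrier_mat n n. \<exists>B\<in>carrier_mat n n. B * A = 1\<^sub>m n \<and> A * B = 1\<^sub>m n}"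
  "monoid.mult (general_linear_group TYPE('r) n) = (*)"
  "one (general_linear_group TYPE('r) n) = 1\<^sub>m n"
  by (auto simp: general_linear_group_def units_of_carrier units_of_mult units_of_one
      Units_def ring_mat_simps)

lemma transvection_in_general_linear_group:
  assumes "i < n" "j < n" "i \<noteq> j"
  shows "transvection n i j (x::'r::ring_1) \<in> carrier (general_linear_group TYPE('r) n)"
proof -
  have "transvection n i j y * transvection n i j (- y) = 1\<^sub>m n" for y :: 'r
  proof -
    have "transvection n i j y * transvection n i j (- y)
        = id_outer n (\<lambda>a. single i y a + single i (- y) a) (single j 1)"
      using assms by (simp add: transvection_eq_id_outer id_outer_mult_same_right)
    also have "(\<lambda>a. single i y a + single i (- y) a) = (\<lambda>_. 0)" by (auto simp: single_def)
    finally show ?thesis by simp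
  qed
  from this[of x] this[of "- x"] show ?thesis
    using assms by (auto simp: general_linear_group_simps transvection_eq_id_outer
        intro!: bexI[of _ "id_outer n (single i (- x)) (single j 1)"])
qed

theorem theorem1:
  fixes n :: nat and I :: "'r::ring_1 set"
  assumes "n > 0"
    and "exchange_ring (ring_of_type_algebra :: 'r ring)"
    and "ideal I (ring_of_type_algebra :: 'r ring)"
  shows "elementary_subgroup_of_level n I \<lhd> general_linear_group TYPE('r) n"
proof -
  let ?G = "general_linear_group TYPE('r) n"
  interpret group ?G by (rule group_general_linear_group)
  define T where "T J = {transvection n i j x | i j x. i < n \<and> j < n \<and> i \<noteq> j \<and> x \<in> J}" for J :: "'r set"
  define E where "E = generate ?G (T UNIV)"
  define N where "N = normal_closure (?G\<lparr>carrier := E\<rparr>) (generate ?G (T I))"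
  have TG: "T J \<subseteq> carrier ?G" for J
    by (auto simp: T_def transvection_in_general_linear_group)
  have E: "subgroup E ?G" unfolding E_def by (rule generate_is_subgroup[OF TG])
  have TE: "T J \<subseteq> E" for J
    unfolding E_def by (auto simp: T_def intro!: generate.incl)
  note N = normal_closure_in_subgroup[OF E TE[of I], folded N_def]
  interpret E: subgroup E ?G by (rule E)
  interpret N: subgroup N ?G by (rule N(1))
  interpret I: ideal I "ring_of_type_algebra :: 'r ring" by (rule assms)
  interpret elementary_normal n I E N
  proof
    show "0 \<in> I" using additive_subgroup.zero_closed[OF I.is_additive_subgroup] by (simp add: ring_of_type_algebra_def)
    show "x + y \<in> I" if "x \<in> I" "y \<in> I" for x y
      using additive_subgroup.a_closed[OF I.is_additive_subgroup that] by (simp add: ring_of_type_algebra_def)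
    show "r * x \<in> I" "x * r \<in> I" if "x \<in> I" for x r
      using I.I_l_closed[OF that] I.I_r_closed[OF that] by (auto simp: ring_of_type_algebra_def)
    show "1\<^sub>m n \<in> E" "1\<^sub>m n \<in> N"
      using E.one_closed N.one_closed by (simp_all add: general_linear_group_simps)
    show "A * B \<in> E" if "A \<in> E" "B \<in> E" for A B
      using E.m_closed[OF that] by (simp add: general_linear_group_simps)
    show "A * B \<in> N" if "A \<in> N" "B \<in> N" for A B
      using N.m_closed[OF that] by (simp add: general_linear_group_simps)
    show "transvection n i j r \<in> E" if "i < n" "j < n" "i \<noteq> j" for i j r
      using TE[of UNIV] that by (auto simp: T_def)
    show "transvection n i j x \<in> N" if "i < n" "j < n" "i \<noteq> j" "x \<in> I" for i j x
      using N(3) generate.incl[of "transvection n i j x" "T I" ?G] that by (auto simp: T_def)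
    show "B * A * C \<in> N" if "A \<in> N" "B \<in> E" "C \<in> E" "B * C = 1\<^sub>m n" "C * B = 1\<^sub>m n" for A B C
    proof -
      have "inv\<^bsub>?G\<^esub> B = C"
        using that by (intro inv_equality E.mem_carrier) (auto simp: general_linear_group_simps(2,3))
      then show ?thesis using N(4)[OF that(2,1)] by (simp add: general_linear_group_simps)
    qed
  qed
  have "N \<lhd> ?G"
    unfolding N_def
  proof (rule normal_closure_in_subgroup_normal[OF E TE], fold N_def)
    fix g t assume g: "g \<in> carrier ?G" and "t \<in> T I"
    then obtain i j x where ij: "i < n" "j < n" "i \<noteq> j" and x: "x \<in> I" and t: "t = transvection n i j x"
      by (auto simp: T_def)
    let ?h = "inv\<^bsub>?G\<^esub> g"
    have gh: "g \<in> carrier_mat n n" "?h \<in> carrier_mat n n" "g * ?h = 1\<^sub>m n" "?h * g = 1\<^sub>m n"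
      using g inv_closed[OF g] r_inv[OF g] l_inv[OF g] by (auto simp: general_linear_group_simps)
    have hg: "(\<Sum>k<n. ?h $$ (a, k) * g $$ (k, b)) = (if a = b then 1 else 0)" if "a < n" "b < n" for a b
      using arg_cong[OF gh(4), of "\<lambda>A. A $$ (a, b)"] that gh(1,2)
      by (auto simp: scalar_prod_def lessThan_atLeast0)
    \<comment> \<open>The \<open>j\<close>-th row of \<open>?h\<close> is right unimodular: its
      product with the \<open>j\<close>-th column of \<open>g\<close> is \<open>1\<close>.\<close>
    obtain c where c: "\<And>k. k < n \<Longrightarrow> ?h $$ (j, k) * c k * (?h $$ (j, k) * c k) = ?h $$ (j, k) * c k"
      "(\<Sum>k<n. ?h $$ (j, k) * c k) = 1"
      by (rule exchange_ring_idempotents[OF assms(2), where n = n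
          and w = "\<lambda>k. ?h $$ (j, k)" and u = "\<lambda>k. g $$ (k, j)"])
        (use hg[OF ij(2,2)] in auto)
    have "g * t * ?h = id_outer n (\<lambda>a. \<Sum>k<n. g $$ (a, k) * single i x k) (\<lambda>b. \<Sum>k<n. single j 1 k * ?h $$ (k, b))"
      unfolding t transvection_eq_id_outer[OF ij] by (rule id_outer_conjugate[OF gh(1-3)])
    also have "\<dots> = id_outer n (\<lambda>a. g $$ (a, i) * x) (\<lambda>b. ?h $$ (j, b))"
      using ij by simp
    also have "\<dots> \<in> N"
    \<comment> \<open>The distinct indices \<open>i\<close> and \<open>j\<close> force
      \<open>n \<ge> 2\<close>; for \<open>n = 1\<close> there is no generator. Orthogonality is the
      vanishing of the entry \<open>(j, i)\<close> of \<open>?h * g\<close>.\<close>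
    proof (rule id_outer_unimodular_in_N[OF _ _ _ c])
      show "(\<Sum>a<n. ?h $$ (j, a) * (g $$ (a, i) * x)) = 0"
        using hg[OF ij(2,1)] ij(3) by (simp flip: mult.assoc sum_distrib_right)
    qed (use ij x I_lmult in auto)
    finally show "g \<otimes>\<^bsub>?G\<^esub> t \<otimes>\<^bsub>?G\<^esub> ?h \<in> N" by (simp add: general_linear_group_simps)
  qed
  then show ?thesis
    by (simp add: elementary_subgroup_of_level_def elementary_subgroup_def N_def E_def T_def)
qed

end
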